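(* Let $M$ denote either the sphere $\mathbb{S}^2$ or the torus $\mathbb{T}^2$. Then for every $\varphi\in\dot H^1(M)$ $$\|\varphi\|_{L_4}^4\le \mathrm{k}_{\mathrm{Lad}}\,\|\varphi\|^2\,\|\nabla\varphi\|^2,$$ where the best constant $\mathrm{k}_{\mathrm{Lad}}=\mathrm{k}_{\mathrm{Lad}}(M)$ in this inequality satisfies $$\mathrm{k}_{\mathrm{Lad}}\le\mathrm{k}_{\mathrm{LT}},$$ with $\mathrm{k}_{\mathrm{LT}}=\mathrm{k}_{\mathrm{LT}}(M)$ the Lieb--Thirring constant of $M$.
   Context: $\mathbb{S}^2$ is the unit sphere in $\mathbb{R}^3$ with its standard round metric and surface measure. $\mathbb{T}^2$ is the flat two-dimensional torus with equal periods, i.e. $\mathbb{R}^2/(L\mathbb{Z})^2$ for some $L>0$. Functions are scalar and real-valued. $\dot H^1(M)$ is the space of $\psi\in H^1(M)$ with $\int_M\psi\,dM=0$. $\|\cdot\|$ is the $L_2(M)$ norm and $\|\cdot\|_{L_4}$ the $L_4(M)$ norm. The Lieb--Thirring constant $\mathrm{k}_{\mathrm{LT}}(M)$ is the smallest constant $\mathrm{k}$ such that for every $N\ge1$ and every family $\{\psi_j\}_{j=1}^N\subset\dot H^1(M)$ orthonormal in $L_2(M)$, the function $\rho(x)=\sum_{j=1}^N|\psi_j(x)|^2$ satisfies $\int_M\rho(x)^2\,dM\le \mathrm{k}\sum_{j=1}^N\|\nabla\psi_j\|^2$. *)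

theory Defs
  imports "HOL-Analysis.Analysis"
begin

text \<open>
  A compact surface is presented by its surface measure and by the relation ``\<open>f\<close> is a
  \<open>C\<^sup>1\<close> function on the surface and \<open>g\<close> is its Riemannian gradient field''.  Gradients take
  values in the ambient Euclidean space.
\<close>

record 'a surface =
  area :: "'a measure"
  C1_grad :: "('a \<Rightarrow> real) \<Rightarrow> ('a \<Rightarrow> 'a) \<Rightarrow> bool"

text \<open>
  The round unit sphere in spherical coordinates: polar angle \<open>\<theta>\<close>, azimuth \<open>\<phi>\<close>, area element
  \<open>sin \<theta> d\<theta> d\<phi>\<close>; the omitted meridian is a null set.
\<close>

definition spherical :: "real \<times> real \<Rightarrow> real ^ 3" where
  "spherical = (\<lambda>(\<theta>, \<phi>). vector [sin \<theta> * cos \<phi>, sin \<theta> * sin \<phi>, cos \<theta>])"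

definition sphere_area :: "(real ^ 3) measure" where
  "sphere_area =
     distr (density lborel
             (\<lambda>p. ennreal (sin (fst p)) * indicator ({0<..<pi} \<times> {0<..<2 * pi}) p))
       (restrict_space borel (sphere 0 1)) spherical"

text \<open>
  A \<open>C\<^sup>1\<close> function on the sphere is the restriction of a \<open>C\<^sup>1\<close> function on a neighbourhood; its
  Riemannian gradient is the tangential part of the Euclidean gradient \<open>D\<close> of any such extension.
\<close>

definition sphere_C1_grad :: "(real ^ 3 \<Rightarrow> real) \<Rightarrow> (real ^ 3 \<Rightarrow> real ^ 3) \<Rightarrow> bool" where
  "sphere_C1_grad f g \<longleftrightarrow>
     (\<exists>U F D. open U \<and> sphere 0 1 \<subseteq> U \<and> (\<forall>x\<in>U. GDERIV F x :> D x) \<and> continuous_on U D \<and>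
        (\<forall>x\<in>sphere 0 1. f x = F x \<and> g x = D x - (D x \<bullet> x) *\<^sub>R x))"

definition sphere2 :: "(real ^ 3) surface" where
  "sphere2 = \<lparr>area = sphere_area, C1_grad = sphere_C1_grad\<rparr>"

text \<open>
  The flat torus of period \<open>L\<close>: functions live on the fundamental cell \<open>[0, L)\<^sup>2\<close>, and the \<open>C\<^sup>1\<close>
  functions are those given by \<open>C\<^sup>1\<close> functions on the plane that are \<open>L\<close>-periodic in both
  coordinates.
\<close>

definition torus_area :: "real \<Rightarrow> (real ^ 2) measure" where
  "torus_area L = restrict_space lborel {x. \<forall>i. 0 \<le> x $ i \<and> x $ i < L}"

definition torus_C1_grad :: "real \<Rightarrow> (real ^ 2 \<Rightarrow> real) \<Rightarrow> (real ^ 2 \<Rightarrow> real ^ 2) \<Rightarrow> bool" where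
  "torus_C1_grad L f g \<longleftrightarrow>
     (\<forall>x i. f (x + axis i L) = f x) \<and> (\<forall>x. GDERIV f x :> g x) \<and> continuous_on UNIV g"

definition torus2 :: "real \<Rightarrow> (real ^ 2) surface" where
  "torus2 L = \<lparr>area = torus_area L, C1_grad = torus_C1_grad L\<rparr>"

definition square_integrable :: "'a measure \<Rightarrow> ('a \<Rightarrow> 'b::euclidean_space) \<Rightarrow> bool" where
  "square_integrable \<mu> f \<longleftrightarrow> f \<in> borel_measurable \<mu> \<and> integrable \<mu> (\<lambda>x. (norm (f x))\<^sup>2)"

definition L2_norm :: "'a measure \<Rightarrow> ('a \<Rightarrow> 'b::euclidean_space) \<Rightarrow> real" where
  "L2_norm \<mu> f = sqrt (\<integral>x. (norm (f x))\<^sup>2 \<partial>\<mu>)"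

text \<open>Only meaningful together with integrability of \<open>\<lambda>x. \<bar>f x\<bar> ^ 4\<close>.\<close>

definition L4_norm :: "'a measure \<Rightarrow> ('a \<Rightarrow> real) \<Rightarrow> real" where
  "L4_norm \<mu> f = root 4 (\<integral>x. \<bar>f x\<bar> ^ 4 \<partial>\<mu>)"

text \<open>
  \<open>H1 M \<psi> G\<close>: \<open>\<psi> \<in> H\<^sup>1(M)\<close> with \<open>\<nabla>\<psi> = G\<close>, where \<open>H\<^sup>1(M)\<close> is the completion of the \<open>C\<^sup>1\<close> functions
  in the norm \<open>(\<parallel>f\<parallel>\<^sup>2 + \<parallel>\<nabla>f\<parallel>\<^sup>2)\<^sup>1\<^sup>/\<^sup>2\<close>, realised in \<open>L\<^sub>2\<close>.  On the sphere and the tori \<open>G\<close> is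
  determined by \<open>\<psi>\<close> up to a null set.
\<close>

definition H1 :: "'a::euclidean_space surface \<Rightarrow> ('a \<Rightarrow> real) \<Rightarrow> ('a \<Rightarrow> 'a) \<Rightarrow> bool" where
  "H1 M \<psi> G \<longleftrightarrow>
     square_integrable (area M) \<psi> \<and> square_integrable (area M) G \<and>
     (\<exists>f g. (\<forall>n. C1_grad M (f n) (g n)) \<and>
        (\<lambda>n. L2_norm (area M) (\<lambda>x. f n x - \<psi> x)) \<longlonglongrightarrow> 0 \<and>
        (\<lambda>n. L2_norm (area M) (\<lambda>x. g n x - G x)) \<longlonglongrightarrow> 0)"

definition H1_dot :: "'a::euclidean_space surface \<Rightarrow> ('a \<Rightarrow> real) \<Rightarrow> ('a \<Rightarrow> 'a) \<Rightarrow> bool" where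
  "H1_dot M \<psi> G \<longleftrightarrow> H1 M \<psi> G \<and> (\<integral>x. \<psi> x \<partial>area M) = 0"

text \<open>
  In both inequalities the left-hand integral is required to be finite; the Bochner integral of a
  non-integrable function would be \<open>0\<close>.
\<close>

definition lieb_thirring_inequality :: "'a::euclidean_space surface \<Rightarrow> real \<Rightarrow> bool" where
  "lieb_thirring_inequality M k \<longleftrightarrow>
     (\<forall>N\<ge>1. \<forall>\<psi> G.
        (\<forall>j\<in>{1..N::nat}. H1_dot M (\<psi> j) (G j)) \<longrightarrow>
        (\<forall>i\<in>{1..N}. \<forall>j\<in>{1..N}. (\<integral>x. \<psi> i x * \<psi> j x \<partial>area M) = (if i = j then 1 else 0)) \<longrightarrow>
        (let \<rho> = (\<lambda>x. \<Sum>j=1..N. \<bar>\<psi> j x\<bar>\<^sup>2) in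
           integrable (area M) (\<lambda>x. (\<rho> x)\<^sup>2) \<and>
           (\<integral>x. (\<rho> x)\<^sup>2 \<partial>area M) \<le> k * (\<Sum>j=1..N. (L2_norm (area M) (G j))\<^sup>2)))"

definition ladyzhenskaya_inequality :: "'a::euclidean_space surface \<Rightarrow> real \<Rightarrow> bool" where
  "ladyzhenskaya_inequality M k \<longleftrightarrow>
     (\<forall>\<phi> G. H1_dot M \<phi> G \<longrightarrow>
        integrable (area M) (\<lambda>x. \<bar>\<phi> x\<bar> ^ 4) \<and>
        L4_norm (area M) \<phi> ^ 4 \<le> k * (L2_norm (area M) \<phi>)\<^sup>2 * (L2_norm (area M) G)\<^sup>2)"

definition best_constant :: "(real \<Rightarrow> bool) \<Rightarrow> real \<Rightarrow> bool" where
  "best_constant P k \<longleftrightarrow> P k \<and> (\<forall>k'. P k' \<longrightarrow> k \<le> k')"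

end

theory Submission
  imports Defs
begin

text \<open>
  The Lieb--Thirring inequality for a single function (\<open>N = 1\<close>) is the Ladyzhenskaya inequality
  for functions of unit \<open>L\<^sub>2\<close> norm, since then \<open>\<rho>\<^sup>2 = \<bar>\<psi>\<bar>\<^sup>4\<close>. Both sides of the Ladyzhenskaya
  inequality are homogeneous of degree four, so dividing \<open>\<phi>\<close> by \<open>\<parallel>\<phi>\<parallel>\<close> gives the general case
  with the same constant; this is \<open>lieb_thirring_imp_ladyzhenskaya\<close>. The geometry of the surface
  enters only through the linearity of the gradient: multiples of \<open>C\<^sup>1\<close> functions are \<open>C\<^sup>1\<close>.

  That a best Ladyzhenskaya constant exists at all has to be shown as well. The admissible constants
  form a closed set, which is nonempty because it contains \<open>k\<^sub>L\<^sub>T\<close>, so what matters is that it is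
  bounded below, that is, that some mean-free \<open>\<phi>\<close> has \<open>\<parallel>\<phi>\<parallel> \<parallel>\<nabla>\<phi>\<parallel> \<noteq> 0\<close>. The existence of a
  least Lieb--Thirring constant supplies such a function on any surface: if all gradients of orthonormal families vanished, the
  Lieb--Thirring inequality would not depend on its constant, and there would be no least one
  (\<open>best_lieb_thirring_imp_nontrivial\<close>).
\<close>

definition C1_scalable :: "'a::euclidean_space surface \<Rightarrow> bool" where
  "C1_scalable M \<longleftrightarrow>
     (\<forall>f g c. C1_grad M f g \<longrightarrow> C1_grad M (\<lambda>x. c * f x) (\<lambda>x. c *\<^sub>R g x))"

lemma GDERIV_cmult:
  assumes "GDERIV F x :> D"
  shows "GDERIV (\<lambda>x. c * F x) x :> c *\<^sub>R D"
  using GDERIV_mult[OF GDERIV_const assms, of c] by simp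

lemma C1_scalable_sphere2: "C1_scalable sphere2"
proof -
  have "sphere_C1_grad (\<lambda>x. c * f x) (\<lambda>x. c *\<^sub>R g x)" if "sphere_C1_grad f g" for f g c
  proof -
    from that obtain U F D where U: "open U" "sphere 0 1 \<subseteq> U" "continuous_on U D"
      and F: "\<And>x. x \<in> U \<Longrightarrow> GDERIV F x :> D x"
      and fg: "\<And>x. x \<in> sphere 0 1 \<Longrightarrow> f x = F x \<and> g x = D x - (D x \<bullet> x) *\<^sub>R x"
      unfolding sphere_C1_grad_def by blast
    have "\<forall>x\<in>U. GDERIV (\<lambda>x. c * F x) x :> c *\<^sub>R D x"
      using F by (blast intro: GDERIV_cmult)
    moreover have "continuous_on U (\<lambda>x. c *\<^sub>R D x)"
      using U by (intro continuous_intros)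
    moreover have "\<forall>x\<in>sphere 0 1. c * f x = c * F x \<and>
        c *\<^sub>R g x = c *\<^sub>R D x - ((c *\<^sub>R D x) \<bullet> x) *\<^sub>R x"
      using fg by (simp add: scaleR_diff_right)
    ultimately show ?thesis
      unfolding sphere_C1_grad_def using U(1,2)
      by (intro exI[of _ U] exI[of _ "\<lambda>x. c * F x"] exI[of _ "\<lambda>x. c *\<^sub>R D x"]) blast
  qed
  then show ?thesis by (simp add: C1_scalable_def sphere2_def)
qed

lemma C1_scalable_torus2: "C1_scalable (torus2 L)"
  by (auto simp: C1_scalable_def torus2_def torus_C1_grad_def
      intro!: GDERIV_cmult continuous_intros)

lemma L2_norm_nonneg: "0 \<le> L2_norm \<mu> f"
  by (simp add: L2_norm_def)

lemma L2_norm_power2: "(L2_norm \<mu> f)\<^sup>2 = (\<integral>x. (norm (f x))\<^sup>2 \<partial>\<mu>)"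
  by (simp add: L2_norm_def)

lemma L2_norm_scaleR: "L2_norm \<mu> (\<lambda>x. c *\<^sub>R f x) = \<bar>c\<bar> * L2_norm \<mu> f"
  by (simp add: L2_norm_def power_mult_distrib real_sqrt_mult)

lemma L4_norm_power4: "L4_norm \<mu> f ^ 4 = (\<integral>x. \<bar>f x\<bar> ^ 4 \<partial>\<mu>)"
  by (simp add: L4_norm_def)

lemma square_integrable_scaleR:
  assumes "square_integrable \<mu> f"
  shows "square_integrable \<mu> (\<lambda>x. c *\<^sub>R f x)"
  using assms by (auto simp: square_integrable_def power_mult_distrib)

lemma H1_scale:
  assumes M: "C1_scalable M" and H: "H1 M \<psi> G"
  shows "H1 M (\<lambda>x. c * \<psi> x) (\<lambda>x. c *\<^sub>R G x)"
proof -
  from H obtain f g where fg: "\<And>n. C1_grad M (f n) (g n)"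
    and f: "(\<lambda>n. L2_norm (area M) (\<lambda>x. f n x - \<psi> x)) \<longlonglongrightarrow> 0"
    and g: "(\<lambda>n. L2_norm (area M) (\<lambda>x. g n x - G x)) \<longlonglongrightarrow> 0"
    unfolding H1_def by blast
  have f': "(\<lambda>n. L2_norm (area M) (\<lambda>x. c * f n x - c * \<psi> x)) \<longlonglongrightarrow> 0"
    using tendsto_mult_right_zero[OF f, of "\<bar>c\<bar>"]
    by (simp flip: L2_norm_scaleR add: right_diff_distrib)
  have g': "(\<lambda>n. L2_norm (area M) (\<lambda>x. c *\<^sub>R g n x - c *\<^sub>R G x)) \<longlonglongrightarrow> 0"
    using tendsto_mult_right_zero[OF g, of "\<bar>c\<bar>"]
    by (simp flip: L2_norm_scaleR add: scaleR_diff_right)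
  have "square_integrable (area M) (\<lambda>x. c * \<psi> x)"
    using H square_integrable_scaleR[of "area M" \<psi> c] by (simp add: H1_def)
  moreover have "square_integrable (area M) (\<lambda>x. c *\<^sub>R G x)"
    using H by (simp add: H1_def square_integrable_scaleR)
  moreover have "\<forall>n. C1_grad M (\<lambda>x. c * f n x) (\<lambda>x. c *\<^sub>R g n x)"
    using M fg by (simp add: C1_scalable_def)
  ultimately show ?thesis
    unfolding H1_def using f' g'
    by (intro conjI exI[of _ "\<lambda>n x. c * f n x"] exI[of _ "\<lambda>n x. c *\<^sub>R g n x"])
qed

lemma H1_dot_scale:
  assumes "C1_scalable M" and "H1_dot M \<psi> G"
  shows "H1_dot M (\<lambda>x. c * \<psi> x) (\<lambda>x. c *\<^sub>R G x)"
  using assms by (simp add: H1_dot_def H1_scale)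

lemma lieb_thirring_single:
  assumes LT: "lieb_thirring_inequality M k"
    and H: "H1_dot M \<psi> G" and unit: "L2_norm (area M) \<psi> = 1"
  shows "integrable (area M) (\<lambda>x. \<bar>\<psi> x\<bar> ^ 4)"
    and "(\<integral>x. \<bar>\<psi> x\<bar> ^ 4 \<partial>area M) \<le> k * (L2_norm (area M) G)\<^sup>2"
proof -
  have "(\<integral>x. \<psi> x * \<psi> x \<partial>area M) = 1"
    using L2_norm_power2[of "area M" \<psi>] unit by (simp add: power2_eq_square)
  then show "integrable (area M) (\<lambda>x. \<bar>\<psi> x\<bar> ^ 4)"
    and "(\<integral>x. \<bar>\<psi> x\<bar> ^ 4 \<partial>area M) \<le> k * (L2_norm (area M) G)\<^sup>2"
    using LT[unfolded lieb_thirring_inequality_def, rule_format, of 1 "\<lambda>_. \<psi>" "\<lambda>_. G"] H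
    by (simp_all add: Let_def flip: power_mult)
qed

lemma lieb_thirring_imp_ladyzhenskaya:
  assumes M: "C1_scalable M" and LT: "lieb_thirring_inequality M k"
  shows "ladyzhenskaya_inequality M k"
  unfolding ladyzhenskaya_inequality_def
proof (intro allI impI)
  fix \<phi> G
  assume H: "H1_dot M \<phi> G"
  define a where "a = L2_norm (area M) \<phi>"
  have sq: "square_integrable (area M) \<phi>"
    using H by (simp add: H1_dot_def H1_def)
  show "integrable (area M) (\<lambda>x. \<bar>\<phi> x\<bar> ^ 4) \<and>
      L4_norm (area M) \<phi> ^ 4 \<le> k * (L2_norm (area M) \<phi>)\<^sup>2 * (L2_norm (area M) G)\<^sup>2"
  proof (cases "a = 0")
    case True
    \<comment> \<open>Normalisation is impossible here, but \<open>\<phi>\<close> vanishes almost everywhere.\<close>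
    have "(\<integral>x. (norm (\<phi> x))\<^sup>2 \<partial>area M) = 0"
      using True L2_norm_power2[of "area M" \<phi>] by (simp add: a_def)
    then have "AE x in area M. (norm (\<phi> x))\<^sup>2 = 0"
      using sq by (subst (asm) integral_nonneg_eq_0_iff_AE) (auto simp: square_integrable_def)
    then have ae: "AE x in area M. \<bar>\<phi> x\<bar> ^ 4 = 0"
      by simp
    have meas: "(\<lambda>x. \<bar>\<phi> x\<bar> ^ 4) \<in> borel_measurable (area M)"
      using sq by (auto simp: square_integrable_def)
    have "integrable (area M) (\<lambda>x. \<bar>\<phi> x\<bar> ^ 4)"
      using integrable_cong_AE[OF meas _ ae] by simp
    moreover have "(\<integral>x. \<bar>\<phi> x\<bar> ^ 4 \<partial>area M) = 0"
      using ae by (rule integral_eq_zero_AE)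
    ultimately show ?thesis
      using True by (simp add: L4_norm_power4 a_def)
  next
    case False
    then have a: "a > 0"
      using L2_norm_nonneg[of "area M" \<phi>] by (simp add: a_def)
    define \<psi> where "\<psi> = (\<lambda>x. inverse a * \<phi> x)"
    have H': "H1_dot M \<psi> (\<lambda>x. inverse a *\<^sub>R G x)"
      unfolding \<psi>_def using M H by (rule H1_dot_scale)
    have unit: "L2_norm (area M) \<psi> = 1"
      using a L2_norm_scaleR[of "area M" "inverse a" \<phi>] by (simp add: \<psi>_def a_def)
    have \<phi>: "\<bar>\<phi> x\<bar> ^ 4 = a ^ 4 * \<bar>\<psi> x\<bar> ^ 4" for x
      using a by (simp add: \<psi>_def abs_mult power_mult_distrib field_simps)
    note single = lieb_thirring_single[OF LT H' unit]
    have "integrable (area M) (\<lambda>x. \<bar>\<phi> x\<bar> ^ 4)"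
      unfolding \<phi> using single(1) by simp
    moreover have "L4_norm (area M) \<phi> ^ 4 \<le> k * a\<^sup>2 * (L2_norm (area M) G)\<^sup>2"
    proof -
      have "L4_norm (area M) \<phi> ^ 4 = a ^ 4 * (\<integral>x. \<bar>\<psi> x\<bar> ^ 4 \<partial>area M)"
        unfolding L4_norm_power4 \<phi> by simp
      also have "\<dots> \<le> a ^ 4 * (k * (L2_norm (area M) (\<lambda>x. inverse a *\<^sub>R G x))\<^sup>2)"
        using single(2) a by (intro mult_left_mono) auto
      also have "\<dots> = k * a\<^sup>2 * (L2_norm (area M) G)\<^sup>2"
        using a by (simp add: L2_norm_scaleR power_mult_distrib field_simps power2_eq_square
            power4_eq_xxxx)
      finally show ?thesis .
    qed
    ultimately show ?thesis by (simp add: a_def)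
  qed
qed

text \<open>
  A family that violates the inequality for the constant \<open>k - 1\<close> but satisfies it for \<open>k\<close> must
  contain a member whose gradient is not zero.
\<close>

lemma best_lieb_thirring_imp_nontrivial:
  assumes "best_constant (lieb_thirring_inequality M) k"
  shows "\<exists>\<psi> G. H1_dot M \<psi> G \<and> L2_norm (area M) \<psi> = 1 \<and> 0 < L2_norm (area M) G"
proof -
  have LT: "lieb_thirring_inequality M k" and "\<not> lieb_thirring_inequality M (k - 1)"
    using assms by (force simp: best_constant_def)+
  then obtain N \<psi> G where N: "N \<ge> (1::nat)"
    and H: "\<forall>j\<in>{1..N}. H1_dot M (\<psi> j) (G j)"
    and orth: "\<forall>i\<in>{1..N}. \<forall>j\<in>{1..N}.
        (\<integral>x. \<psi> i x * \<psi> j x \<partial>area M) = (if i = j then 1 else 0)"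
    and viol: "\<not> (let \<rho> = (\<lambda>x. \<Sum>j=1..N. \<bar>\<psi> j x\<bar>\<^sup>2) in
        integrable (area M) (\<lambda>x. (\<rho> x)\<^sup>2) \<and>
        (\<integral>x. (\<rho> x)\<^sup>2 \<partial>area M) \<le> (k - 1) * (\<Sum>j=1..N. (L2_norm (area M) (G j))\<^sup>2))"
    unfolding lieb_thirring_inequality_def by blast
  have sat: "let \<rho> = (\<lambda>x. \<Sum>j=1..N. \<bar>\<psi> j x\<bar>\<^sup>2) in
        integrable (area M) (\<lambda>x. (\<rho> x)\<^sup>2) \<and>
        (\<integral>x. (\<rho> x)\<^sup>2 \<partial>area M) \<le> k * (\<Sum>j=1..N. (L2_norm (area M) (G j))\<^sup>2)"
    using LT[unfolded lieb_thirring_inequality_def] N H orth by blast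
  have "(\<Sum>j=1..N. (L2_norm (area M) (G j))\<^sup>2) \<noteq> 0"
    using viol sat by (auto simp: Let_def)
  then obtain j where j: "j \<in> {1..N}" and "(L2_norm (area M) (G j))\<^sup>2 \<noteq> 0"
    by (meson sum.neutral)
  then have "0 < L2_norm (area M) (G j)"
    using L2_norm_nonneg[of "area M" "G j"] by simp
  moreover have "L2_norm (area M) (\<psi> j) = 1"
    using orth j by (simp add: L2_norm_def power2_eq_square)
  ultimately show ?thesis using H j by blast
qed

text \<open>
  The infimum of the admissible constants is again admissible, since each \<open>\<phi>\<close> with
  \<open>\<parallel>\<phi>\<parallel> \<parallel>\<nabla>\<phi>\<parallel> \<noteq> 0\<close> bounds them from below by a quotient, and for other \<open>\<phi>\<close> the inequality
  does not involve the constant.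
\<close>

lemma best_ladyzhenskaya_exists:
  fixes M :: "'a::euclidean_space surface"
  assumes Lad: "ladyzhenskaya_inequality M k"
    and H: "H1_dot M \<psi> G" and \<psi>: "0 < L2_norm (area M) \<psi>" and G: "0 < L2_norm (area M) G"
  shows "\<exists>k'. best_constant (ladyzhenskaya_inequality M) k'"
proof -
  let ?K = "{k. ladyzhenskaya_inequality M k}"
  define A where "A = (\<lambda>(\<phi> :: 'a \<Rightarrow> real) (G :: 'a \<Rightarrow> 'a).
      (L2_norm (area M) \<phi>)\<^sup>2 * (L2_norm (area M) G)\<^sup>2)"
  have ineq: "L4_norm (area M) \<phi> ^ 4 \<le> k' * A \<phi> G"
    if "ladyzhenskaya_inequality M k'" "H1_dot M \<phi> G" for k' \<phi> G
    using that by (simp add: ladyzhenskaya_inequality_def A_def mult.assoc)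
  have "0 \<le> k'" if "ladyzhenskaya_inequality M k'" for k'
  proof -
    have "0 \<le> L4_norm (area M) \<psi> ^ 4" by simp
    also have "\<dots> \<le> k' * A \<psi> G" using that H by (rule ineq)
    finally have "0 \<le> k' * A \<psi> G" .
    moreover have "0 < A \<psi> G"
      unfolding A_def using \<psi> G by (intro mult_pos_pos zero_less_power)
    ultimately show ?thesis by (simp add: zero_le_mult_iff)
  qed
  then have bdd: "bdd_below ?K" by (intro bdd_belowI[of _ 0]) auto
  have "L4_norm (area M) \<phi> ^ 4 \<le> Inf ?K * A \<phi> G" if \<phi>: "H1_dot M \<phi> G" for \<phi> G
  proof (cases "A \<phi> G = 0")
    case True
    then show ?thesis using ineq[OF Lad \<phi>] by simp
  next
    case False
    then have pos: "0 < A \<phi> G" by (simp add: A_def)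
    have "L4_norm (area M) \<phi> ^ 4 / A \<phi> G \<le> Inf ?K"
      using Lad ineq[OF _ \<phi>] pos by (intro cInf_greatest) (auto simp: pos_divide_le_eq)
    then show ?thesis using pos by (simp add: pos_divide_le_eq)
  qed
  then have "ladyzhenskaya_inequality M (Inf ?K)"
    using Lad by (simp add: ladyzhenskaya_inequality_def A_def mult.assoc)
  then show ?thesis
    using cInf_lower[OF _ bdd] unfolding best_constant_def by blast
qed

lemma best_ladyzhenskaya_le_lieb_thirring:
  assumes M: "C1_scalable M" and best: "best_constant (lieb_thirring_inequality M) k"
  shows "\<exists>k'. best_constant (ladyzhenskaya_inequality M) k' \<and> k' \<le> k"
proof -
  have Lad: "ladyzhenskaya_inequality M k"
    using M best by (auto simp: best_constant_def intro: lieb_thirring_imp_ladyzhenskaya)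
  obtain \<psi> G where H: "H1_dot M \<psi> G"
    and \<psi>: "L2_norm (area M) \<psi> = 1" and G: "0 < L2_norm (area M) G"
    using best_lieb_thirring_imp_nontrivial[OF best] by blast
  have "0 < L2_norm (area M) \<psi>" using \<psi> by simp
  then obtain k' where "best_constant (ladyzhenskaya_inequality M) k'"
    using best_ladyzhenskaya_exists[OF Lad H _ G] by blast
  with Lad show ?thesis unfolding best_constant_def by blast
qed

theorem corollary1p1:
  shows "(\<forall>k\<^sub>L\<^sub>T. best_constant (lieb_thirring_inequality sphere2) k\<^sub>L\<^sub>T \<longrightarrow>
            (\<exists>k\<^sub>L\<^sub>a\<^sub>d. best_constant (ladyzhenskaya_inequality sphere2) k\<^sub>L\<^sub>a\<^sub>d \<and> k\<^sub>L\<^sub>a\<^sub>d \<le> k\<^sub>L\<^sub>T)) \<and>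
         (\<forall>L>0. \<forall>k\<^sub>L\<^sub>T. best_constant (lieb_thirring_inequality (torus2 L)) k\<^sub>L\<^sub>T \<longrightarrow>
            (\<exists>k\<^sub>L\<^sub>a\<^sub>d. best_constant (ladyzhenskaya_inequality (torus2 L)) k\<^sub>L\<^sub>a\<^sub>d \<and> k\<^sub>L\<^sub>a\<^sub>d \<le> k\<^sub>L\<^sub>T))"
  by (intro conjI allI impI best_ladyzhenskaya_le_lieb_thirring
      C1_scalable_sphere2 C1_scalable_torus2)

end
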